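(* Let $(\varepsilon_n)_{n=0}^N$ be a sequence of integrable random variables on $(\Omega, \mathcal{F}, \mathbb{P})$. Then $$V_0 \ge \mathbb{E}\left[ \max_{0 \le n \le N} \left( g(n,X_n) - M^H_n - \varepsilon_n \right) \right] + \mathbb{E}\left[ \min_{0 \le n \le N} \left( A^H_n + \varepsilon_n \right) \right].$$ Moreover, if $\mathbb{E}[\varepsilon_n \mid \mathcal{F}_n] = 0$ for all $n \in \{0,1,\dots,N\}$, then $$V_0 \le \mathbb{E}\left[ \max_{0 \le n \le N} \left( g(n,X_n) - M_n - \varepsilon_n \right) \right]$$ for every $(\mathcal{F}_n)$-martingale $(M_n)_{n=0}^N$ starting from $0$.
   Context: Let $N$ and $d$ be positive integers and let $X = (X_n)_{n=0}^N$ be an $\mathbb{R}^d$-valued discrete-time Markov process on a probability space $(\Omega, \mathcal{F}, \mathbb{P})$. Let $\mathcal{F}_n$ be the $\sigma$-algebra generated by $X_0, X_1, \dots, X_n$. An $X$-stopping time is a random variable $\tau \colon \Omega \to \{0,1,\dots,N\}$ such that $\{\tau = n\} \in \mathcal{F}_n$ for all $n \in \{0,1,\dots,N\}$; $\mathcal{T}$ denotes the set of all $X$-stopping times, and $\mathcal{T}_n$ the set of all $X$-stopping times $\tau$ satisfying $n \le \tau \le N$. Let $g \colon \{0,1,\dots,N\} \times \mathbb{R}^d \to \mathbb{R}$ be a measurable function satisfying $\mathbb{E}\,|g(n,X_n)| < \infty$ for all $n \in \{0,1,\dots,N\}$, and let $V_0 = \sup_{\tau \in \mathcal{T}} \mathbb{E}\,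 g(\tau, X_\tau)$. The Snell envelope $(H_n)_{n=0}^N$ of the reward process $(g(n,X_n))_{n=0}^N$ is the smallest (in the $\mathbb{P}$-almost sure order) supermartingale with respect to $(\mathcal{F}_n)_{n=0}^N$ that dominates $(g(n,X_n))_{n=0}^N$; it is given, up to $\mathbb{P}$-almost sure equality, by $$H_n = \operatorname{ess\,sup}_{\tau \in \mathcal{T}_n} \mathbb{E}[g(\tau,X_\tau) \mid \mathcal{F}_n], \quad n = 0,1,\dots,N.$$ Its Doob--Meyer decomposition is $H_n = H_0 + M^H_n - A^H_n$, where, up to $\mathbb{P}$-almost sure equality, $M^H$ is the $(\mathcal{F}_n)$-martingale given by $M^H_0 = 0$ and $M^H_n - M^H_{n-1} = H_n - \mathbb{E}[H_n \mid \mathcal{F}_{n-1}]$ for $n = 1, \dots, N$, and $A^H$ is the nondecreasing $(\mathcal{F}_n)$-predictable process given by $A^H_0 = 0$ and $A^H_n - A^H_{n-1} = H_{n-1} - \mathbb{E}[H_n \mid \mathcal{F}_{n-1}]$ for $n = 1, \dots, N$. *)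

theory Defs
  imports "HOL-Probability.Probability"
begin

definition nat_filtration :: "'a measure \<Rightarrow> (nat \<Rightarrow> 'a \<Rightarrow> 'b::topological_space) \<Rightarrow> nat \<Rightarrow> 'a measure"
  where "nat_filtration M X n =
    sigma (space M) (\<Union>k\<le>n. {X k -` B \<inter> space M | B. B \<in> sets borel})"

definition markov_process ::
    "'a measure \<Rightarrow> nat \<Rightarrow> (nat \<Rightarrow> 'a \<Rightarrow> 'b::topological_space) \<Rightarrow> bool"
  where "markov_process M N X \<longleftrightarrow>
    (\<forall>n\<le>N. X n \<in> borel_measurable M) \<and>
    (\<forall>n<N. \<forall>B\<in>sets borel.
      AE \<omega> in M.
        real_cond_exp M (nat_filtration M X n) (\<lambda>\<omega>. indicator B (X (Suc n) \<omega>)) \<omega> =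
        real_cond_exp M (vimage_algebra (space M) (X n) borel) (\<lambda>\<omega>. indicator B (X (Suc n) \<omega>)) \<omega>)"

definition stopping_times :: "'a measure \<Rightarrow> (nat \<Rightarrow> 'a measure) \<Rightarrow> nat \<Rightarrow> ('a \<Rightarrow> nat) set"
  where "stopping_times M F N =
    {\<tau>. (\<forall>\<omega>\<in>space M. \<tau> \<omega> \<le> N) \<and> (\<forall>n\<le>N. {\<omega> \<in> space M. \<tau> \<omega> = n} \<in> sets (F n))}"

definition martingale :: "'a measure \<Rightarrow> (nat \<Rightarrow> 'a measure) \<Rightarrow> nat \<Rightarrow> (nat \<Rightarrow> 'a \<Rightarrow> real) \<Rightarrow> bool"
  where "martingale M F N Y \<longleftrightarrow>
    (\<forall>n\<le>N. Y n \<in> borel_measurable (F n) \<and> integrable M (Y n)) \<and>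
    (\<forall>n<N. AE \<omega> in M. real_cond_exp M (F n) (Y (Suc n)) \<omega> = Y n \<omega>)"

definition supermartingale :: "'a measure \<Rightarrow> (nat \<Rightarrow> 'a measure) \<Rightarrow> nat \<Rightarrow> (nat \<Rightarrow> 'a \<Rightarrow> real) \<Rightarrow> bool"
  where "supermartingale M F N Y \<longleftrightarrow>
    (\<forall>n\<le>N. Y n \<in> borel_measurable (F n) \<and> integrable M (Y n)) \<and>
    (\<forall>n<N. AE \<omega> in M. real_cond_exp M (F n) (Y (Suc n)) \<omega> \<le> Y n \<omega>)"

definition dominates :: "'a measure \<Rightarrow> nat \<Rightarrow> (nat \<Rightarrow> 'a \<Rightarrow> real) \<Rightarrow> (nat \<Rightarrow> 'a \<Rightarrow> real) \<Rightarrow> bool"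
  where "dominates M N Y Z \<longleftrightarrow> (\<forall>n\<le>N. AE \<omega> in M. Z n \<omega> \<le> Y n \<omega>)"

text \<open>The Snell envelope is unique only up to almost sure equality, so it is a predicate
  satisfied by every version; \<open>snell_envelope_exists\<close> below shows that there is one.\<close>

definition snell_envelope ::
    "'a measure \<Rightarrow> (nat \<Rightarrow> 'a measure) \<Rightarrow> nat \<Rightarrow> (nat \<Rightarrow> 'a \<Rightarrow> real) \<Rightarrow> (nat \<Rightarrow> 'a \<Rightarrow> real) \<Rightarrow> bool"
  where "snell_envelope M F N Z H \<longleftrightarrow>
    supermartingale M F N H \<and> dominates M N H Z \<and>
    (\<forall>S. supermartingale M F N S \<and> dominates M N S Z \<longrightarrow> dominates M N S H)"

text \<open>Doob decomposition \<open>H n = H 0 + doob_mart n - doob_comp n\<close>, computed with the version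
  of the conditional expectation chosen by \<^const>\<open>real_cond_exp\<close>; \<open>is_version\<close> below
  admits all other versions.\<close>

primrec doob_mart :: "'a measure \<Rightarrow> (nat \<Rightarrow> 'a measure) \<Rightarrow> (nat \<Rightarrow> 'a \<Rightarrow> real) \<Rightarrow> nat \<Rightarrow> 'a \<Rightarrow> real"
  where
    "doob_mart M F H 0 = (\<lambda>\<omega>. 0)"
  | "doob_mart M F H (Suc n) =
      (\<lambda>\<omega>. doob_mart M F H n \<omega> + (H (Suc n) \<omega> - real_cond_exp M (F n) (H (Suc n)) \<omega>))"

primrec doob_comp :: "'a measure \<Rightarrow> (nat \<Rightarrow> 'a measure) \<Rightarrow> (nat \<Rightarrow> 'a \<Rightarrow> real) \<Rightarrow> nat \<Rightarrow> 'a \<Rightarrow> real"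
  where
    "doob_comp M F H 0 = (\<lambda>\<omega>. 0)"
  | "doob_comp M F H (Suc n) =
      (\<lambda>\<omega>. doob_comp M F H n \<omega> + (H n \<omega> - real_cond_exp M (F n) (H (Suc n)) \<omega>))"

definition is_version :: "'a measure \<Rightarrow> nat \<Rightarrow> (nat \<Rightarrow> 'a \<Rightarrow> real) \<Rightarrow> (nat \<Rightarrow> 'a \<Rightarrow> real) \<Rightarrow> bool"
  where "is_version M N Y Y' \<longleftrightarrow>
    (\<forall>n\<le>N. Y' n \<in> borel_measurable M \<and> (AE \<omega> in M. Y' n \<omega> = Y n \<omega>))"

definition optimal_value ::
    "'a measure \<Rightarrow> nat \<Rightarrow> (nat \<Rightarrow> 'a \<Rightarrow> 'b::topological_space) \<Rightarrow> (nat \<Rightarrow> 'b \<Rightarrow> real) \<Rightarrow> real"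
  where "optimal_value M N X g =
    (SUP \<tau>\<in>stopping_times M (nat_filtration M X) N. \<integral>\<omega>. g (\<tau> \<omega>) (X (\<tau> \<omega>) \<omega>) \<partial>M)"

lemma space_nat_filtration: "space (nat_filtration M X n) = space M"
  unfolding nat_filtration_def by (rule space_measure_of) auto

lemma sets_nat_filtration_mono:
  "m \<le> n \<Longrightarrow> sets (nat_filtration M X m) \<subseteq> sets (nat_filtration M X n)"
  unfolding nat_filtration_def
  by (subst (1 2) sets_measure_of, force, force, rule sigma_sets_mono') fastforce

lemma stopping_times_eq_stopping_time:
  "stopping_times M (nat_filtration M X) N =
    {\<tau>. (\<forall>\<omega>\<in>space M. \<tau> \<omega> \<le> N) \<and> stopping_time (nat_filtration M X) \<tau>}"
proof (intro set_eqI iffI)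
  fix \<tau> :: "'a \<Rightarrow> nat"
  assume t: "\<tau> \<in> stopping_times M (nat_filtration M X) N"
  have "{\<omega> \<in> space M. \<tau> \<omega> \<le> n} \<in> sets (nat_filtration M X n)" for n
  proof -
    have "{\<omega> \<in> space M. \<tau> \<omega> \<le> n} = (\<Union>k\<le>min n N. {\<omega> \<in> space M. \<tau> \<omega> = k})"
      using t by (auto simp: stopping_times_def)
    also have "\<dots> \<in> sets (nat_filtration M X n)"
      using t sets_nat_filtration_mono[of _ n M X]
      by (intro sets.finite_UN) (auto simp: stopping_times_def)
    finally show ?thesis .
  qed
  then show "\<tau> \<in> {\<tau>. (\<forall>\<omega>\<in>space M. \<tau> \<omega> \<le> N) \<and> stopping_time (nat_filtration M X) \<tau>}"
    using t by (auto simp: stopping_times_def stopping_time_def pred_def space_nat_filtration)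
next
  fix \<tau> :: "'a \<Rightarrow> nat"
  assume t: "\<tau> \<in> {\<tau>. (\<forall>\<omega>\<in>space M. \<tau> \<omega> \<le> N) \<and> stopping_time (nat_filtration M X) \<tau>}"
  have le: "{\<omega> \<in> space M. \<tau> \<omega> \<le> n} \<in> sets (nat_filtration M X n)" for n
    using t by (auto simp: stopping_time_def pred_def space_nat_filtration)
  have "{\<omega> \<in> space M. \<tau> \<omega> = n} \<in> sets (nat_filtration M X n)" for n
  proof (cases n)
    case 0
    then show ?thesis using le[of 0] by simp
  next
    case (Suc m)
    have "{\<omega> \<in> space M. \<tau> \<omega> = n} = {\<omega> \<in> space M. \<tau> \<omega> \<le> n} - {\<omega> \<in> space M. \<tau> \<omega> \<le> m}"
      using Suc by auto
    then show ?thesis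
      using le[of n] le[of m] sets_nat_filtration_mono[of m n M X] Suc by auto
  qed
  then show "\<tau> \<in> stopping_times M (nat_filtration M X) N"
    using t by (auto simp: stopping_times_def)
qed

lemma snell_envelope_exists:
  assumes "prob_space M"
    and sub: "\<And>n. n \<le> N \<Longrightarrow> subalgebra M (F n)"
    and ad: "\<And>n. n \<le> N \<Longrightarrow> Z n \<in> borel_measurable (F n)"
    and int: "\<And>n. n \<le> N \<Longrightarrow> integrable M (Z n)"
  shows "\<exists>H. snell_envelope M F N Z H"
proof -
  interpret prob_space M by fact
  have sfs: "sigma_finite_subalgebra M (F n)" if "n \<le> N" for n
  proof -
    interpret finite_measure_subalgebra M "F n" by standard (rule sub[OF that])
    show ?thesis by unfold_locales
  qed
  define W where "W = rec_nat (Z N) (\<lambda>k w \<omega>. max (Z (N - Suc k) \<omega>) (real_cond_exp M (F (N - Suc k)) w \<omega>))"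
  have W0: "W 0 = Z N" and WS: "\<And>k. W (Suc k) = (\<lambda>\<omega>. max (Z (N - Suc k) \<omega>) (real_cond_exp M (F (N - Suc k)) (W k) \<omega>))"
    by (simp_all add: W_def)
  define H where "H n = W (N - n)" for n
  have HN: "H N = Z N" by (simp add: H_def W0)
  have Hn: "H n = (\<lambda>\<omega>. max (Z n \<omega>) (real_cond_exp M (F n) (H (Suc n)) \<omega>))" if "n < N" for n
  proof -
    have e: "N - n = Suc (N - Suc n)" and e2: "N - Suc (N - Suc n) = n" using that by auto
    show ?thesis unfolding H_def by (subst e) (simp only: WS e2)
  qed
  have H: "H n \<in> borel_measurable (F n) \<and> integrable M (H n)" if "n \<le> N" for n
    using that
  proof (induction rule: inc_induct)
    case base then show ?case using ad int by (simp add: HN)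
  next
    case (step n)
    interpret sigma_finite_subalgebra M "F n" using sfs step by simp
    have "real_cond_exp M (F n) (H (Suc n)) \<in> borel_measurable (F n)"
      by (rule borel_measurable_cond_exp)
    then show ?case using step ad[of n] int[of n] real_cond_exp_int(1)[of "H (Suc n)"]
      by (subst (1 2) Hn) auto
  qed
  have "dominates M N S H" if S: "supermartingale M F N S" "dominates M N S Z" for S
  proof -
    have "AE \<omega> in M. H n \<omega> \<le> S n \<omega>" if "n \<le> N" for n
      using that
    proof (induction rule: inc_induct)
      case base then show ?case using S by (simp add: HN dominates_def)
    next
      case (step n)
      interpret sigma_finite_subalgebra M "F n" using sfs step by simp
      have "AE \<omega> in M. real_cond_exp M (F n) (H (Suc n)) \<omega> \<le> real_cond_exp M (F n) (S (Suc n)) \<omega>"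
        using step H[of "Suc n"] S by (intro real_cond_exp_mono) (auto simp: supermartingale_def)
      moreover have "AE \<omega> in M. real_cond_exp M (F n) (S (Suc n)) \<omega> \<le> S n \<omega>"
        using S step by (simp add: supermartingale_def)
      moreover have "AE \<omega> in M. Z n \<omega> \<le> S n \<omega>"
        using S step by (simp add: dominates_def)
      ultimately show ?case by eventually_elim (use step in \<open>simp add: Hn\<close>)
    qed
    then show ?thesis by (simp add: dominates_def)
  qed
  moreover have "supermartingale M F N H"
    unfolding supermartingale_def using H by (auto simp: Hn)
  moreover have "dominates M N H Z"
  proof -
    have "Z n \<omega> \<le> H n \<omega>" if "n \<le> N" for n \<omega>
      using that by (cases "n = N") (simp_all add: HN Hn)
    then show ?thesis by (simp add: dominates_def)
  qed
  ultimately show ?thesis unfolding snell_envelope_def by blast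
qed

end

theory Submission
  imports Defs
begin

text \<open>
  Replacing the Snell envelope \<open>H\<close> by \<open>max (Z n) (E[H (n + 1) | F n])\<close> yields again a
  supermartingale dominating \<open>Z\<close>, so by minimality \<open>H n \<le> max (Z n) (E[H (n + 1) | F n])\<close>, and
  stopping at the first time the maximum is attained by \<open>Z n\<close> shows \<open>E[H 0] \<le> V 0\<close>. Since
  \<open>g - MH - \<epsilon> \<le> H 0 - (AH + \<epsilon>)\<close>, this gives the lower bound. For the upper bound, a martingale
  starting from \<open>0\<close>, as well as errors with \<open>E[\<epsilon> n | F n] = 0\<close>, have mean zero when evaluated at a
  stopping time.
\<close>

section \<open>Maxima and minima over finitely many times\<close>

text \<open>Each \<open>b n\<close> is at least the minimum, so every \<open>a n\<close> lies below
  \<open>c\<close> minus that minimum. In the lower bound this is used pathwise, with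
  \<open>c\<close> the value of \<open>H 0\<close>, so that the errors cancel between
  \<open>a\<close> and \<open>b\<close> before anything is integrated.\<close>

lemma max_plus_min_le:
  fixes a b :: "nat \<Rightarrow> real"
  assumes "\<And>n. n \<le> N \<Longrightarrow> a n + b n \<le> c"
  shows "(MAX n\<in>{0..N}. a n) + (MIN n\<in>{0..N}. b n) \<le> c"
proof -
  have "a n \<le> c - (MIN n\<in>{0..N}. b n)" if "n \<le> N" for n
  proof -
    have "(MIN n\<in>{0..N}. b n) \<le> b n"
      using that by (intro Min_le) auto
    then show ?thesis using assms[OF that] by linarith
  qed
  then have "(MAX n\<in>{0..N}. a n) \<le> c - (MIN n\<in>{0..N}. b n)"
    by (subst Max_le_iff) auto
  then show ?thesis by linarith
qed

lemma integrable_MAX: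
  fixes f :: "nat \<Rightarrow> 'a \<Rightarrow> real"
  assumes "\<And>n. n \<le> N \<Longrightarrow> integrable M (f n)"
  shows "integrable M (\<lambda>\<omega>. MAX n\<in>{0..N}. f n \<omega>)"
  using assms
proof (induction N)
  case (Suc N)
  have "(MAX n\<in>{0..Suc N}. f n \<omega>) = max (f (Suc N) \<omega>) (MAX n\<in>{0..N}. f n \<omega>)" for \<omega>
    by (simp add: atLeast0_atMost_Suc)
  with Suc show ?case by simp
qed simp

lemma integrable_MIN:
  fixes f :: "nat \<Rightarrow> 'a \<Rightarrow> real"
  assumes "\<And>n. n \<le> N \<Longrightarrow> integrable M (f n)"
  shows "integrable M (\<lambda>\<omega>. MIN n\<in>{0..N}. f n \<omega>)"
  using assms
proof (induction N)
  case (Suc N)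
  have "(MIN n\<in>{0..Suc N}. f n \<omega>) = min (f (Suc N) \<omega>) (MIN n\<in>{0..N}. f n \<omega>)" for \<omega>
    by (simp add: atLeast0_atMost_Suc)
  with Suc show ?case by simp
qed simp

section \<open>Stopped processes on a finite horizon\<close>

text \<open>Common setting of both bounds, with an abstract reward process \<open>Z\<close>. The
  theorem instantiates \<open>F\<close> with \<open>nat_filtration M X\<close> and
  \<open>Z n\<close> with \<open>g n\<close> composed with \<open>X n\<close>.\<close>

locale finite_horizon_filtration = prob_space M for M :: "'a measure" +
  fixes F :: "nat \<Rightarrow> 'a measure" and N :: nat
  assumes subalg: "n \<le> N \<Longrightarrow> subalgebra M (F n)"
    and sets_mono: "m \<le> n \<Longrightarrow> n \<le> N \<Longrightarrow> sets (F m) \<subseteq> sets (F n)"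
begin

lemma sigma_finite_sub: "n \<le> N \<Longrightarrow> sigma_finite_subalgebra M (F n)"
proof -
  assume n: "n \<le> N"
  interpret finite_measure_subalgebra M "F n" by standard (rule subalg[OF n])
  show ?thesis by unfold_locales
qed

lemma sets_F: "A \<in> sets (F n) \<Longrightarrow> n \<le> N \<Longrightarrow> A \<in> sets M"
  using subalg by (auto simp: subalgebra_def)

lemma space_F: "n \<le> N \<Longrightarrow> space (F n) = space M"
  using subalg by (auto simp: subalgebra_def)

lemma stopping_times_sets:
  "\<tau> \<in> stopping_times M F N \<Longrightarrow> n \<le> N \<Longrightarrow> {\<omega> \<in> space M. \<tau> \<omega> = n} \<in> sets (F n)"
  by (simp add: stopping_times_def)

text \<open>Splitting along the finitely many events where \<tau> equals \<open>n\<close> turns a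
  random time into fixed times. Only on \<open>space M\<close> is \<tau> bounded by
  \<open>N\<close>, hence the restriction on \<omega>.\<close>

lemma stopped_eq_sum:
  fixes Z :: "nat \<Rightarrow> 'a \<Rightarrow> real"
  assumes "\<tau> \<in> stopping_times M F N" "\<omega> \<in> space M"
  shows "Z (\<tau> \<omega>) \<omega> = (\<Sum>n\<le>N. indicator {\<omega> \<in> space M. \<tau> \<omega> = n} \<omega> *\<^sub>R Z n \<omega>)"
proof -
  have "(\<Sum>n\<le>N. indicator {\<omega> \<in> space M. \<tau> \<omega> = n} \<omega> *\<^sub>R Z n \<omega>) =
      (\<Sum>n\<le>N. if \<tau> \<omega> = n then Z n \<omega> else 0)"
    using assms by (intro sum.cong) auto
  also have "\<dots> = Z (\<tau> \<omega>) \<omega>"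
    using assms by (simp add: stopping_times_def)
  finally show ?thesis by simp
qed

lemma
  fixes Z :: "nat \<Rightarrow> 'a \<Rightarrow> real"
  assumes \<tau>: "\<tau> \<in> stopping_times M F N"
    and Z: "\<And>n. n \<le> N \<Longrightarrow> integrable M (Z n)"
  shows integrable_stopped: "integrable M (\<lambda>\<omega>. Z (\<tau> \<omega>) \<omega>)"
    and integral_stopped:
      "(\<integral>\<omega>. Z (\<tau> \<omega>) \<omega> \<partial>M) = (\<Sum>n\<le>N. \<integral>\<omega>\<in>{\<omega> \<in> space M. \<tau> \<omega> = n}. Z n \<omega> \<partial>M)"
proof -
  have i: "integrable M (\<lambda>\<omega>. indicator {\<omega> \<in> space M. \<tau> \<omega> = n} \<omega> *\<^sub>R Z n \<omega>)" if "n \<le> N" for n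
    using Z[OF that] sets_F[OF stopping_times_sets[OF \<tau> that] that]
    by (rule integrable_mult_indicator[rotated])
  show "integrable M (\<lambda>\<omega>. Z (\<tau> \<omega>) \<omega>)"
    by (subst Bochner_Integration.integrable_cong[OF refl stopped_eq_sum[OF \<tau>]], assumption)
      (intro Bochner_Integration.integrable_sum i, simp)
  show "(\<integral>\<omega>. Z (\<tau> \<omega>) \<omega> \<partial>M) = (\<Sum>n\<le>N. \<integral>\<omega>\<in>{\<omega> \<in> space M. \<tau> \<omega> = n}. Z n \<omega> \<partial>M)"
    unfolding set_lebesgue_integral_def
    by (subst Bochner_Integration.integral_cong[OF refl stopped_eq_sum[OF \<tau>]], assumption)
      (intro Bochner_Integration.integral_sum i, simp)
qed

text \<open>Since \<tau> never exceeds \<open>N\<close>, every stopped reward lies below the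
  pathwise maximum, which is integrable. Without boundedness a real supremum would not be known to
  be an upper bound.\<close>

lemma bdd_above_stopped_values:
  fixes Z :: "nat \<Rightarrow> 'a \<Rightarrow> real"
  assumes Z: "\<And>n. n \<le> N \<Longrightarrow> integrable M (Z n)"
  shows "bdd_above ((\<lambda>\<tau>. \<integral>\<omega>. Z (\<tau> \<omega>) \<omega> \<partial>M) ` stopping_times M F N)"
proof (rule bdd_aboveI2)
  fix \<tau> assume \<tau>: "\<tau> \<in> stopping_times M F N"
  show "(\<integral>\<omega>. Z (\<tau> \<omega>) \<omega> \<partial>M) \<le> (\<integral>\<omega>. (MAX n\<in>{0..N}. Z n \<omega>) \<partial>M)"
    using \<tau>
    by (intro integral_mono integrable_stopped[where Z = Z, OF \<tau> Z] integrable_MAX Z Max_ge)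
      (auto simp: stopping_times_def)
qed

lemma const_stopping_time:
  assumes k: "k \<le> N"
  shows "(\<lambda>_. k) \<in> stopping_times M F N"
proof -
  have "{\<omega> \<in> space M. k = n} \<in> sets (F n)" if n: "n \<le> N" for n
  proof (cases "n = k")
    case True
    then show ?thesis using sets.top[of "F n"] n by (simp add: space_F)
  qed simp
  then show ?thesis using k unfolding stopping_times_def by blast
qed

section \<open>Optional stopping\<close>

text \<open>Downward induction from \<open>N\<close>: a set of \<open>F n\<close> also belongs to
  \<open>F (Suc n)\<close>, and on it \<open>Y n\<close> integrates like \<open>Y (Suc n)\<close> by
  the defining property of conditional expectation.\<close>

lemma martingale_set_integral:
  assumes Y: "martingale M F N Y" and "n \<le> N" and A: "A \<in> sets (F n)"
  shows "(\<integral>\<omega>\<in>A. Y n \<omega> \<partial>M) = (\<integral>\<omega>\<in>A. Y N \<omega> \<partial>M)"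
  using \<open>n \<le> N\<close> A
proof (induction rule: inc_induct)
  case (step n)
  interpret sigma_finite_subalgebra M "F n" using sigma_finite_sub step by simp
  have A: "A \<in> sets M" "A \<in> sets (F (Suc n))"
    using step.prems step.hyps sets_F[of A n] sets_mono[of n "Suc n"] by auto
  have m: "Y n \<in> borel_measurable M" "integrable M (Y (Suc n))"
    and ae: "AE \<omega> in M. real_cond_exp M (F n) (Y (Suc n)) \<omega> = Y n \<omega>"
    using Y step.hyps by (auto simp: martingale_def intro!: borel_measurable_integrable)
  have "(\<integral>\<omega>\<in>A. Y n \<omega> \<partial>M) = (\<integral>\<omega>\<in>A. real_cond_exp M (F n) (Y (Suc n)) \<omega> \<partial>M)"
    by (rule set_lebesgue_integral_cong_AE) (use ae m A in auto)
  also have "\<dots> = (\<integral>\<omega>\<in>A. Y (Suc n) \<omega> \<partial>M)"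
    using real_cond_exp_intA[OF m(2) step.prems] by simp
  also have "\<dots> = (\<integral>\<omega>\<in>A. Y N \<omega> \<partial>M)" by (rule step.IH[OF A(2)])
  finally show ?case .
qed simp

lemma optional_stopping:
  assumes Y: "martingale M F N Y" and \<tau>: "\<tau> \<in> stopping_times M F N"
  shows "(\<integral>\<omega>. Y (\<tau> \<omega>) \<omega> \<partial>M) = (\<integral>\<omega>. Y 0 \<omega> \<partial>M)"
proof -
  have int: "integrable M (Y n)" if "n \<le> N" for n
    using Y that by (simp add: martingale_def)
  \<comment> \<open>On the event that \<sigma> equals \<open>n\<close>, \<open>Y n\<close> may be
    replaced by \<open>Y N\<close>. The second use of \<open>integral_stopped\<close>, for the
    process constantly \<open>Y N\<close>, reassembles the pieces. The claim then follows by
    comparing \<tau> with the constant time 0.\<close>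
  have terminal: "(\<integral>\<omega>. Y (\<sigma> \<omega>) \<omega> \<partial>M) = (\<integral>\<omega>. Y N \<omega> \<partial>M)" if \<sigma>: "\<sigma> \<in> stopping_times M F N" for \<sigma>
    using martingale_set_integral[OF Y] stopping_times_sets[OF \<sigma>]
    by (simp add: integral_stopped[OF \<sigma>, of Y] integral_stopped[OF \<sigma>, of "\<lambda>_. Y N"] int)
  show ?thesis
    using terminal[OF \<tau>] terminal[OF const_stopping_time[OF le0]] by simp
qed

text \<open>The event that \<tau> equals \<open>n\<close> lies in \<open>F n\<close>, so
  \<open>e n\<close> integrates over it like its conditional expectation, that is, to 0. This is not
  an instance of optional stopping: \<open>e\<close> need not be adapted, and if it were, each
  \<open>e n\<close> would vanish almost surely.\<close>

lemma integral_stopped_eq_0: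
  assumes int: "\<And>n. n \<le> N \<Longrightarrow> integrable M (e n)"
    and ce: "\<And>n. n \<le> N \<Longrightarrow> AE \<omega> in M. real_cond_exp M (F n) (e n) \<omega> = 0"
    and \<tau>: "\<tau> \<in> stopping_times M F N"
  shows "(\<integral>\<omega>. e (\<tau> \<omega>) \<omega> \<partial>M) = 0"
proof -
  have "(\<integral>\<omega>\<in>A. e n \<omega> \<partial>M) = 0" if n: "n \<le> N" and A: "A \<in> sets (F n)" for n A
  proof -
    interpret sigma_finite_subalgebra M "F n" using sigma_finite_sub[OF n] .
    have "(\<integral>\<omega>\<in>A. e n \<omega> \<partial>M) = (\<integral>\<omega>\<in>A. real_cond_exp M (F n) (e n) \<omega> \<partial>M)"
      by (rule real_cond_exp_intA[OF int[OF n] A])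
    also have "\<dots> = (\<integral>\<omega>\<in>A. 0 \<partial>M)"
      by (rule set_lebesgue_integral_cong_AE) (use ce[OF n] sets_F[OF A n] in auto)
    finally show ?thesis by simp
  qed
  moreover have "(\<integral>\<omega>. e (\<tau> \<omega>) \<omega> \<partial>M) = (\<Sum>n\<le>N. \<integral>\<omega>\<in>{\<omega> \<in> space M. \<tau> \<omega> = n}. e n \<omega> \<partial>M)"
    by (rule integral_stopped[OF \<tau> int])
  ultimately show ?thesis
    using stopping_times_sets[OF \<tau>] by simp
qed

section \<open>The Snell envelope and an optimal stopping time\<close>

text \<open>Minimality of \<open>H\<close> is tested against the competitor \<open>S\<close>, built
  from \<open>H\<close> by one step of dynamic programming. Both conclusions are the resulting
  inequality between \<open>H\<close> and \<open>S\<close>, read at \<open>N\<close> and before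
  \<open>N\<close>.\<close>

lemma
  assumes H: "snell_envelope M F N Z H"
    and Z: "\<And>n. n \<le> N \<Longrightarrow> Z n \<in> borel_measurable (F n)" "\<And>n. n \<le> N \<Longrightarrow> integrable M (Z n)"
  shows snell_envelope_terminal_le: "AE \<omega> in M. H N \<omega> \<le> Z N \<omega>"
    and snell_envelope_step_le:
      "n < N \<Longrightarrow> AE \<omega> in M. H n \<omega> \<le> max (Z n \<omega>) (real_cond_exp M (F n) (H (Suc n)) \<omega>)"
proof -
  \<comment> \<open>At \<open>N\<close> no continuation value exists inside the horizon, so
    \<open>S\<close> takes the terminal reward there.\<close>
  define S where "S n = (if n < N
    then (\<lambda>\<omega>. max (Z n \<omega>) (real_cond_exp M (F n) (H (Suc n)) \<omega>)) else Z n)" for n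
  have Hm: "H n \<in> borel_measurable (F n)" "integrable M (H n)" if "n \<le> N" for n
    using H that by (auto simp: snell_envelope_def supermartingale_def)
  have Sm: "S n \<in> borel_measurable (F n) \<and> integrable M (S n)" if n: "n \<le> N" for n
  proof (cases "n < N")
    case True
    interpret sigma_finite_subalgebra M "F n" using sigma_finite_sub[OF n] .
    show ?thesis
      using True Z[OF n] Hm[of "Suc n"] real_cond_exp_int(1)[of "H (Suc n)"]
        borel_measurable_cond_exp[of M "F n" "H (Suc n)"]
      by (auto simp: S_def)
  qed (use Z[OF n] in \<open>simp add: S_def\<close>)
  have SH: "AE \<omega> in M. S n \<omega> \<le> H n \<omega>" if n: "n \<le> N" for n
  proof -
    have "AE \<omega> in M. Z n \<omega> \<le> H n \<omega>"
      using H n by (auto simp: snell_envelope_def dominates_def)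
    moreover have "AE \<omega> in M. n < N \<longrightarrow> real_cond_exp M (F n) (H (Suc n)) \<omega> \<le> H n \<omega>"
      using H by (cases "n < N") (auto simp: snell_envelope_def supermartingale_def)
    ultimately show ?thesis by eventually_elim (simp add: S_def)
  qed
  \<comment> \<open>The supermartingale property uses \<open>SH\<close> at time
    \<open>Suc n\<close>: the conditional expectation of \<open>S (Suc n)\<close> is at most that of
    \<open>H (Suc n)\<close>, which is one of the two terms in the maximum
    \<open>S n\<close>.\<close>
  have "AE \<omega> in M. real_cond_exp M (F n) (S (Suc n)) \<omega> \<le> S n \<omega>" if n: "n < N" for n
  proof -
    interpret sigma_finite_subalgebra M "F n" using sigma_finite_sub n by simp
    have "AE \<omega> in M. real_cond_exp M (F n) (S (Suc n)) \<omega> \<le> real_cond_exp M (F n) (H (Suc n)) \<omega>"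
      using n Sm Hm SH by (intro real_cond_exp_mono) auto
    then show ?thesis by eventually_elim (use n in \<open>simp add: S_def\<close>)
  qed
  moreover have "dominates M N S Z"
    by (auto simp: dominates_def S_def)
  ultimately have "dominates M N S H"
    using H Sm by (auto simp: snell_envelope_def supermartingale_def)
  then have le: "AE \<omega> in M. H n \<omega> \<le> S n \<omega>" if "n \<le> N" for n
    using that by (simp add: dominates_def)
  show "AE \<omega> in M. H N \<omega> \<le> Z N \<omega>"
    using le[of N] by (simp add: S_def)
  show "AE \<omega> in M. H n \<omega> \<le> max (Z n \<omega>) (real_cond_exp M (F n) (H (Suc n)) \<omega>)" if "n < N"
    using le[of n] that by (simp add: S_def)
qed

text \<open>Backward induction. Comparing integrals over all sets of \<open>F n\<close> expresses
  that \<open>H n\<close> is at most the conditional expectation of the stopped reward given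
  \<open>F n\<close>. This localized form is what allows the induction hypothesis to be applied only
  where stopping is postponed.\<close>

lemma snell_envelope_stopping_time:
  assumes H: "snell_envelope M F N Z H"
    and Z: "\<And>n. n \<le> N \<Longrightarrow> Z n \<in> borel_measurable (F n)" "\<And>n. n \<le> N \<Longrightarrow> integrable M (Z n)"
    and "n \<le> N"
  shows "\<exists>\<tau>\<in>stopping_times M F N. (\<forall>\<omega>\<in>space M. n \<le> \<tau> \<omega>) \<and>
    (\<forall>A\<in>sets (F n). (\<integral>\<omega>\<in>A. H n \<omega> \<partial>M) \<le> (\<integral>\<omega>\<in>A. Z (\<tau> \<omega>) \<omega> \<partial>M))"
  using \<open>n \<le> N\<close>
proof (induction rule: inc_induct)
  case base
  have terminal: "AE \<omega> in M. H N \<omega> \<le> Z N \<omega>"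
    using H Z by (rule snell_envelope_terminal_le)
  have "(\<integral>\<omega>\<in>A. H N \<omega> \<partial>M) \<le> (\<integral>\<omega>\<in>A. Z N \<omega> \<partial>M)" if "A \<in> sets (F N)" for A
    unfolding set_lebesgue_integral_def
  proof (rule integral_mono_AE)
    show "integrable M (\<lambda>\<omega>. indicator A \<omega> *\<^sub>R H N \<omega>)" "integrable M (\<lambda>\<omega>. indicator A \<omega> *\<^sub>R Z N \<omega>)"
      using sets_F[OF that] Z(2) H
      by (simp_all add: integrable_mult_indicator snell_envelope_def supermartingale_def
          del: real_scaleR_def)
    show "AE \<omega> in M. indicator A \<omega> *\<^sub>R H N \<omega> \<le> indicator A \<omega> *\<^sub>R Z N \<omega>"
      using terminal by eventually_elim (simp add: indicator_def)
  qed
  moreover have "(\<lambda>_. N) \<in> stopping_times M F N"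
    by (rule const_stopping_time) simp
  ultimately show ?case by (intro bexI[of _ "\<lambda>_. N"]) auto
next
  case (step n)
  then have n: "n \<le> N" "Suc n \<le> N" by auto
  interpret sigma_finite_subalgebra M "F n" using sigma_finite_sub[OF n(1)] .
  obtain \<tau> where \<tau>: "\<tau> \<in> stopping_times M F N" and \<tau>_ge: "\<And>\<omega>. \<omega> \<in> space M \<Longrightarrow> Suc n \<le> \<tau> \<omega>"
    and \<tau>_le: "\<And>A. A \<in> sets (F (Suc n)) \<Longrightarrow>
      (\<integral>\<omega>\<in>A. H (Suc n) \<omega> \<partial>M) \<le> (\<integral>\<omega>\<in>A. Z (\<tau> \<omega>) \<omega> \<partial>M)"
    using step.IH by blast
  define C where "C = real_cond_exp M (F n) (H (Suc n))"
  have Hm: "integrable M (H n)" "integrable M (H (Suc n))"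
    using H n by (auto simp: snell_envelope_def supermartingale_def)
  have step_le: "AE \<omega> in M. H n \<omega> \<le> max (Z n \<omega>) (real_cond_exp M (F n) (H (Suc n)) \<omega>)"
    using H Z step.hyps(2) by (rule snell_envelope_step_le)
  have C: "C \<in> borel_measurable (F n)" "integrable M C"
    using real_cond_exp_int(1)[OF Hm(2)] by (auto simp: C_def)
  \<comment> \<open>On \<open>B\<close> the immediate reward is at least the continuation value. The
    new time \<sigma> stops at \<open>n\<close> on \<open>B\<close> and otherwise follows \<tau>
    from the induction hypothesis.\<close>
  define B where "B = {\<omega> \<in> space M. C \<omega> \<le> Z n \<omega>}"
  have B: "B \<in> sets (F n)"
    using C(1) Z(1)[OF n(1)] unfolding B_def space_F[OF n(1), symmetric] by measurable
  define \<sigma> where "\<sigma> \<omega> = (if \<omega> \<in> B then n else \<tau> \<omega>)" for \<omega>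
  \<comment> \<open>As \<tau> is at least \<open>Suc n\<close>, the event is empty before
    \<open>n\<close> and equal to \<open>B\<close> at \<open>n\<close>. Later it is the
    corresponding event of \<tau> with \<open>B\<close> removed, and \<open>B\<close> is in
    \<open>F n\<close>, hence in \<open>F k\<close>.\<close>
  have "{\<omega> \<in> space M. \<sigma> \<omega> = k} \<in> sets (F k)" if k: "k \<le> N" for k
  proof -
    consider "k < n" | "k = n" | "n < k" by linarith
    then show ?thesis
    proof cases
      case 1
      have "\<sigma> \<omega> \<noteq> k" if "\<omega> \<in> space M" for \<omega>
        using \<tau>_ge[OF that] 1 by (auto simp: \<sigma>_def)
      then have empty: "{\<omega> \<in> space M. \<sigma> \<omega> = k} = {}" by blast
      show ?thesis unfolding empty by simp
    next
      case 2
      have "\<sigma> \<omega> = k \<longleftrightarrow> \<omega> \<in> B" if "\<omega> \<in> space M" for \<omega>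
        using \<tau>_ge[OF that] 2 by (auto simp: \<sigma>_def)
      then have "{\<omega> \<in> space M. \<sigma> \<omega> = k} = B" by (auto simp: B_def)
      then show ?thesis using B 2 by simp
    next
      case 3
      then have "{\<omega> \<in> space M. \<sigma> \<omega> = k} = {\<omega> \<in> space M. \<tau> \<omega> = k} - B"
        by (auto simp: \<sigma>_def)
      then show ?thesis
        using stopping_times_sets[OF \<tau> k] B sets_mono[of n k] 3 k by auto
    qed
  qed
  then have \<sigma>: "\<sigma> \<in> stopping_times M F N"
    using \<tau> n by (auto simp: stopping_times_def \<sigma>_def)
  have "(\<integral>\<omega>\<in>A. H n \<omega> \<partial>M) \<le> (\<integral>\<omega>\<in>A. Z (\<sigma> \<omega>) \<omega> \<partial>M)" if A: "A \<in> sets (F n)" for A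
  proof -
    \<comment> \<open>\<open>A - B\<close> is needed at both times: in \<open>F n\<close> to replace
      \<open>C\<close> by \<open>H (Suc n)\<close>, in \<open>F (Suc n)\<close> to apply
      \<open>\<tau>_le\<close>.\<close>
    have AB: "A \<inter> B \<in> sets (F n)" "A - B \<in> sets (F n)" "A - B \<in> sets (F (Suc n))"
      using A B sets_mono[of n "Suc n"] n by auto
    then have ABM: "A \<inter> B \<in> sets M" "A - B \<in> sets M" "A \<in> sets M"
      using A sets_F n(1) by auto
    have set_int: "set_integrable M D f" if "integrable M f" "D \<in> sets M" for f :: "'a \<Rightarrow> real" and D
      using that unfolding set_integrable_def by (intro integrable_mult_indicator)
    have split: "(\<integral>\<omega>\<in>A. f \<omega> \<partial>M) = (\<integral>\<omega>\<in>A \<inter> B. f \<omega> \<partial>M) + (\<integral>\<omega>\<in>A - B. f \<omega> \<partial>M)"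
      if "integrable M f" for f :: "'a \<Rightarrow> real"
    proof -
      have "(\<integral>\<omega>\<in>(A \<inter> B) \<union> (A - B). f \<omega> \<partial>M) = (\<integral>\<omega>\<in>A \<inter> B. f \<omega> \<partial>M) + (\<integral>\<omega>\<in>A - B. f \<omega> \<partial>M)"
        using that ABM by (intro set_integral_Un set_int) auto
      moreover have "(A \<inter> B) \<union> (A - B) = A" by blast
      ultimately show ?thesis by simp
    qed
    have m: "integrable M (\<lambda>\<omega>. max (Z n \<omega>) (C \<omega>))"
      using Z(2)[OF n(1)] C(2) by simp
    have "(\<integral>\<omega>\<in>A. H n \<omega> \<partial>M) \<le> (\<integral>\<omega>\<in>A. max (Z n \<omega>) (C \<omega>) \<partial>M)"
      unfolding set_lebesgue_integral_def
    proof (rule integral_mono_AE)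
      show "AE \<omega> in M. indicator A \<omega> *\<^sub>R H n \<omega> \<le> indicator A \<omega> *\<^sub>R max (Z n \<omega>) (C \<omega>)"
        using step_le by eventually_elim (simp add: indicator_def C_def)
    qed (intro integrable_mult_indicator ABM Hm m)+
    also have "\<dots> = (\<integral>\<omega>\<in>A \<inter> B. Z n \<omega> \<partial>M) + (\<integral>\<omega>\<in>A - B. C \<omega> \<partial>M)"
    proof -
      have "(\<integral>\<omega>\<in>A \<inter> B. max (Z n \<omega>) (C \<omega>) \<partial>M) = (\<integral>\<omega>\<in>A \<inter> B. Z n \<omega> \<partial>M)"
        using ABM by (intro set_lebesgue_integral_cong) (auto simp: B_def)
      \<comment> \<open>A point outside \<open>B\<close> might merely lie outside
        \<open>space M\<close>. Since \<open>A\<close> is contained in the space, on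
        \<open>A - B\<close> the inequality defining \<open>B\<close> really fails.\<close>
      moreover have "(\<integral>\<omega>\<in>A - B. max (Z n \<omega>) (C \<omega>) \<partial>M) = (\<integral>\<omega>\<in>A - B. C \<omega> \<partial>M)"
        using ABM sets.sets_into_space[OF ABM(3)]
        by (intro set_lebesgue_integral_cong) (auto simp: B_def)
      ultimately show ?thesis by (simp add: split[OF m])
    qed
    also have "(\<integral>\<omega>\<in>A - B. C \<omega> \<partial>M) = (\<integral>\<omega>\<in>A - B. H (Suc n) \<omega> \<partial>M)"
      using real_cond_exp_intA[OF Hm(2) AB(2)] by (simp add: C_def)
    also have "\<dots> \<le> (\<integral>\<omega>\<in>A - B. Z (\<tau> \<omega>) \<omega> \<partial>M)"
      by (rule \<tau>_le[OF AB(3)])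
    also have "(\<integral>\<omega>\<in>A \<inter> B. Z n \<omega> \<partial>M) + (\<integral>\<omega>\<in>A - B. Z (\<tau> \<omega>) \<omega> \<partial>M) = (\<integral>\<omega>\<in>A. Z (\<sigma> \<omega>) \<omega> \<partial>M)"
    proof -
      have "(\<integral>\<omega>\<in>A \<inter> B. Z (\<sigma> \<omega>) \<omega> \<partial>M) = (\<integral>\<omega>\<in>A \<inter> B. Z n \<omega> \<partial>M)"
        using ABM by (intro set_lebesgue_integral_cong) (auto simp: \<sigma>_def)
      moreover have "(\<integral>\<omega>\<in>A - B. Z (\<sigma> \<omega>) \<omega> \<partial>M) = (\<integral>\<omega>\<in>A - B. Z (\<tau> \<omega>) \<omega> \<partial>M)"
        using ABM by (intro set_lebesgue_integral_cong) (auto simp: \<sigma>_def)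
      ultimately show ?thesis by (simp add: split[OF integrable_stopped[where Z = Z, OF \<sigma> Z(2)]])
    qed
    finally show ?thesis by simp
  qed
  moreover have "n \<le> \<sigma> \<omega>" if "\<omega> \<in> space M" for \<omega>
    using \<tau>_ge[OF that] by (simp add: \<sigma>_def)
  ultimately show ?case using \<sigma> by blast
qed

text \<open>The stopping time constructed from time 0 is taken with the whole space as test set. Its
  expected reward is one of the values under the supremum.\<close>

lemma snell_envelope_initial_le:
  assumes H: "snell_envelope M F N Z H"
    and Z: "\<And>n. n \<le> N \<Longrightarrow> Z n \<in> borel_measurable (F n)" "\<And>n. n \<le> N \<Longrightarrow> integrable M (Z n)"
  shows "(\<integral>\<omega>. H 0 \<omega> \<partial>M) \<le> (SUP \<tau>\<in>stopping_times M F N. \<integral>\<omega>. Z (\<tau> \<omega>) \<omega> \<partial>M)"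
proof -
  obtain \<tau> where \<tau>: "\<tau> \<in> stopping_times M F N"
    and le: "\<And>A. A \<in> sets (F 0) \<Longrightarrow> (\<integral>\<omega>\<in>A. H 0 \<omega> \<partial>M) \<le> (\<integral>\<omega>\<in>A. Z (\<tau> \<omega>) \<omega> \<partial>M)"
    using snell_envelope_stopping_time[OF H Z le0] by blast
  have "integrable M (H 0)"
    using H by (simp add: snell_envelope_def supermartingale_def)
  then have "(\<integral>\<omega>. H 0 \<omega> \<partial>M) \<le> (\<integral>\<omega>. Z (\<tau> \<omega>) \<omega> \<partial>M)"
    using le[of "space M"] sets.top[of "F 0"] integrable_stopped[where Z = Z, OF \<tau> Z(2)]
    by (simp add: set_integral_space space_F)
  also have "\<dots> \<le> (SUP \<tau>\<in>stopping_times M F N. \<integral>\<omega>. Z (\<tau> \<omega>) \<omega> \<partial>M)"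
    by (rule cSUP_upper[OF \<tau> bdd_above_stopped_values[where Z = Z, OF Z(2)]])
  finally show ?thesis .
qed

section \<open>Doob decomposition and the lower bound\<close>

lemma
  assumes H: "\<And>n. n \<le> N \<Longrightarrow> integrable M (H n)" and "n \<le> N"
  shows integrable_doob_mart: "integrable M (doob_mart M F H n)"
    and integrable_doob_comp: "integrable M (doob_comp M F H n)"
proof -
  have "integrable M (doob_mart M F H n) \<and> integrable M (doob_comp M F H n)"
    using \<open>n \<le> N\<close>
  proof (induction n)
    case (Suc n)
    interpret sigma_finite_subalgebra M "F n" using sigma_finite_sub Suc.prems by simp
    show ?case using Suc H real_cond_exp_int(1)[OF H[OF Suc.prems]] by simp
  qed simp
  then show "integrable M (doob_mart M F H n)" "integrable M (doob_comp M F H n)" by auto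
qed

text \<open>An identity at every point, with no null set: the same version of the conditional
  expectation enters both increments and cancels.\<close>

lemma doob_decomposition: "H n \<omega> = H 0 \<omega> + doob_mart M F H n \<omega> - doob_comp M F H n \<omega>"
  by (induction n) simp_all

lemma snell_envelope_lower_bound:
  assumes H: "snell_envelope M F N Z H"
    and MH: "is_version M N (doob_mart M F H) MH"
    and AH: "is_version M N (doob_comp M F H) AH"
    and Z: "\<And>n. n \<le> N \<Longrightarrow> Z n \<in> borel_measurable (F n)" "\<And>n. n \<le> N \<Longrightarrow> integrable M (Z n)"
    and e: "\<And>n. n \<le> N \<Longrightarrow> integrable M (e n)"
  shows "(\<integral>\<omega>. (MAX n\<in>{0..N}. Z n \<omega> - MH n \<omega> - e n \<omega>) \<partial>M) +
      (\<integral>\<omega>. (MIN n\<in>{0..N}. AH n \<omega> + e n \<omega>) \<partial>M)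
    \<le> (SUP \<tau>\<in>stopping_times M F N. \<integral>\<omega>. Z (\<tau> \<omega>) \<omega> \<partial>M)"
proof -
  have Hi: "integrable M (H n)" if "n \<le> N" for n
    using H that by (simp add: snell_envelope_def supermartingale_def)
  have MHm: "MH n \<in> borel_measurable M" "AE \<omega> in M. MH n \<omega> = doob_mart M F H n \<omega>" if "n \<le> N" for n
    using MH that by (auto simp: is_version_def)
  have AHm: "AH n \<in> borel_measurable M" "AE \<omega> in M. AH n \<omega> = doob_comp M F H n \<omega>" if "n \<le> N" for n
    using AH that by (auto simp: is_version_def)
  \<comment> \<open>Versions are only required to be measurable and almost surely equal to the
    canonical processes, so integrability is transferred from those.\<close>
  have MHi: "integrable M (MH n)" if n: "n \<le> N" for n
    by (subst integrable_cong_AE[OF MHm(1)[OF n] _ MHm(2)[OF n]])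
      (use integrable_doob_mart[OF Hi n] in auto)
  have AHi: "integrable M (AH n)" if n: "n \<le> N" for n
    by (subst integrable_cong_AE[OF AHm(1)[OF n] _ AHm(2)[OF n]])
      (use integrable_doob_comp[OF Hi n] in auto)
  \<comment> \<open>The sum is \<open>Z n - MH n + AH n\<close>, and \<open>Z n\<close> is at most
    \<open>H n\<close>. Finitely many times allow one null set for all \<open>n\<close>, as the
    pathwise maximum and minimum require.\<close>
  have "AE \<omega> in M. \<forall>n\<in>{..N}. (Z n \<omega> - MH n \<omega> - e n \<omega>) + (AH n \<omega> + e n \<omega>) \<le> H 0 \<omega>"
  proof (rule AE_finite_allI)
    fix n assume "n \<in> {..N}"
    then have n: "n \<le> N" by simp
    have "AE \<omega> in M. Z n \<omega> \<le> H n \<omega>"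
      using H n by (simp add: snell_envelope_def dominates_def)
    then show "AE \<omega> in M. (Z n \<omega> - MH n \<omega> - e n \<omega>) + (AH n \<omega> + e n \<omega>) \<le> H 0 \<omega>"
      using MHm(2)[OF n] AHm(2)[OF n]
    proof eventually_elim
      case (elim \<omega>)
      then show ?case using doob_decomposition[of H n \<omega>] by linarith
    qed
  qed simp
  then have "AE \<omega> in M. (MAX n\<in>{0..N}. Z n \<omega> - MH n \<omega> - e n \<omega>) +
      (MIN n\<in>{0..N}. AH n \<omega> + e n \<omega>) \<le> H 0 \<omega>"
    by eventually_elim (rule max_plus_min_le, simp)
  moreover have max: "integrable M (\<lambda>\<omega>. MAX n\<in>{0..N}. Z n \<omega> - MH n \<omega> - e n \<omega>)"
    by (intro integrable_MAX Bochner_Integration.integrable_diff Z MHi e)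
  moreover have min: "integrable M (\<lambda>\<omega>. MIN n\<in>{0..N}. AH n \<omega> + e n \<omega>)"
    by (intro integrable_MIN Bochner_Integration.integrable_add AHi e)
  ultimately have "(\<integral>\<omega>. (MAX n\<in>{0..N}. Z n \<omega> - MH n \<omega> - e n \<omega>) +
      (MIN n\<in>{0..N}. AH n \<omega> + e n \<omega>) \<partial>M) \<le> (\<integral>\<omega>. H 0 \<omega> \<partial>M)"
    by (intro integral_mono_AE Bochner_Integration.integrable_add Hi) auto
  also have "\<dots> \<le> (SUP \<tau>\<in>stopping_times M F N. \<integral>\<omega>. Z (\<tau> \<omega>) \<omega> \<partial>M)"
    by (rule snell_envelope_initial_le[OF H Z])
  finally show ?thesis using max min by simp
qed

section \<open>The upper bound\<close>

text \<open>Subtracting \<open>Y\<close> and \<open>e\<close> at \<tau> leaves the expected reward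
  unchanged, and the difference at \<tau> is bounded by the pathwise maximum. The bound does not
  depend on \<tau>, so it passes to the supremum.\<close>

lemma martingale_upper_bound:
  assumes Y: "martingale M F N Y" and Y0: "AE \<omega> in M. Y 0 \<omega> = 0"
    and Z: "\<And>n. n \<le> N \<Longrightarrow> integrable M (Z n)"
    and e: "\<And>n. n \<le> N \<Longrightarrow> integrable M (e n)"
      "\<And>n. n \<le> N \<Longrightarrow> AE \<omega> in M. real_cond_exp M (F n) (e n) \<omega> = 0"
  shows "(SUP \<tau>\<in>stopping_times M F N. \<integral>\<omega>. Z (\<tau> \<omega>) \<omega> \<partial>M)
    \<le> (\<integral>\<omega>. (MAX n\<in>{0..N}. Z n \<omega> - Y n \<omega> - e n \<omega>) \<partial>M)"
proof (rule cSUP_least)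
  \<comment> \<open>A real supremum is bounded by a common upper bound only over a nonempty
    set.\<close>
  show "stopping_times M F N \<noteq> {}" using const_stopping_time[OF le0] by blast
next
  fix \<tau> assume \<tau>: "\<tau> \<in> stopping_times M F N"
  have Yi: "integrable M (Y n)" if "n \<le> N" for n
    using Y that by (simp add: martingale_def)
  have "(\<integral>\<omega>. Y (\<tau> \<omega>) \<omega> \<partial>M) = 0"
    using optional_stopping[OF Y \<tau>] integral_eq_zero_AE[OF Y0] by simp
  then have "(\<integral>\<omega>. Z (\<tau> \<omega>) \<omega> \<partial>M) = (\<integral>\<omega>. Z (\<tau> \<omega>) \<omega> - Y (\<tau> \<omega>) \<omega> - e (\<tau> \<omega>) \<omega> \<partial>M)"
    using integral_stopped_eq_0[OF e \<tau>] integrable_stopped[where Z = Z, OF \<tau> Z]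
      integrable_stopped[where Z = Y, OF \<tau> Yi] integrable_stopped[where Z = e, OF \<tau> e(1)]
    by simp
  also have "\<dots> \<le> (\<integral>\<omega>. (MAX n\<in>{0..N}. Z n \<omega> - Y n \<omega> - e n \<omega>) \<partial>M)"
  proof (rule integral_mono)
    show "Z (\<tau> \<omega>) \<omega> - Y (\<tau> \<omega>) \<omega> - e (\<tau> \<omega>) \<omega> \<le> (MAX n\<in>{0..N}. Z n \<omega> - Y n \<omega> - e n \<omega>)"
      if "\<omega> \<in> space M" for \<omega>
      using \<tau> that by (intro Max_ge) (auto simp: stopping_times_def)
  qed (intro integrable_MAX Bochner_Integration.integrable_diff Z Yi e(1)
      integrable_stopped[where Z = Z, OF \<tau> Z] integrable_stopped[where Z = Y, OF \<tau> Yi]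
      integrable_stopped[where Z = e, OF \<tau> e(1)]; assumption)+
  finally show "(\<integral>\<omega>. Z (\<tau> \<omega>) \<omega> \<partial>M) \<le> (\<integral>\<omega>. (MAX n\<in>{0..N}. Z n \<omega> - Y n \<omega> - e n \<omega>) \<partial>M)" .
qed

end

section \<open>The natural filtration and the two bounds for it\<close>

lemma subalgebra_nat_filtration:
  assumes "\<And>k. k \<le> n \<Longrightarrow> X k \<in> borel_measurable M"
  shows "subalgebra M (nat_filtration M X n)"
proof -
  have "sets (nat_filtration M X n) \<subseteq> sets M"
    unfolding nat_filtration_def
    by (subst sets_measure_of, force, rule sets.sigma_sets_subset)
      (use assms in \<open>auto intro: measurable_sets\<close>)
  then show ?thesis by (simp add: subalgebra_def space_nat_filtration)
qed

lemma measurable_nat_filtration: "X n \<in> borel_measurable (nat_filtration M X n)"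
proof (rule measurableI)
  fix A :: "'b set" assume "A \<in> sets borel"
  then show "X n -` A \<inter> space (nat_filtration M X n) \<in> sets (nat_filtration M X n)"
    unfolding space_nat_filtration
    unfolding nat_filtration_def by (subst sets_measure_of, force, intro sigma_sets.Basic) blast
qed simp

theorem proposition7:
  fixes M :: "'a measure"
    and N :: nat
    and X :: "nat \<Rightarrow> 'a \<Rightarrow> real ^ 'd"
    and g :: "nat \<Rightarrow> real ^ 'd \<Rightarrow> real"
    and \<epsilon> :: "nat \<Rightarrow> 'a \<Rightarrow> real"
  assumes "prob_space M"
    and "N > 0"
    and "markov_process M N X"
    and "\<And>n. n \<le> N \<Longrightarrow> g n \<in> borel_measurable borel"
    and "\<And>n. n \<le> N \<Longrightarrow> integrable M (\<lambda>\<omega>. g n (X n \<omega>))"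
    and "\<And>n. n \<le> N \<Longrightarrow> integrable M (\<epsilon> n)"
  shows "(\<forall>H MH AH.
      snell_envelope M (nat_filtration M X) N (\<lambda>n \<omega>. g n (X n \<omega>)) H \<and>
      is_version M N (doob_mart M (nat_filtration M X) H) MH \<and>
      is_version M N (doob_comp M (nat_filtration M X) H) AH \<longrightarrow>
      optimal_value M N X g \<ge>
        (\<integral>\<omega>. (MAX n\<in>{0..N}. g n (X n \<omega>) - MH n \<omega> - \<epsilon> n \<omega>) \<partial>M) +
        (\<integral>\<omega>. (MIN n\<in>{0..N}. AH n \<omega> + \<epsilon> n \<omega>) \<partial>M)) \<and>
    ((\<forall>n\<le>N. AE \<omega> in M. real_cond_exp M (nat_filtration M X n) (\<epsilon> n) \<omega> = 0) \<longrightarrow>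
      (\<forall>Y. martingale M (nat_filtration M X) N Y \<and> (AE \<omega> in M. Y 0 \<omega> = 0) \<longrightarrow>
        optimal_value M N X g \<le>
          (\<integral>\<omega>. (MAX n\<in>{0..N}. g n (X n \<omega>) - Y n \<omega> - \<epsilon> n \<omega>) \<partial>M)))"
proof -
  interpret finite_horizon_filtration M "nat_filtration M X" N
    by (intro finite_horizon_filtration.intro finite_horizon_filtration_axioms.intro
        assms(1) subalgebra_nat_filtration sets_nat_filtration_mono)
      (use assms(3) in \<open>auto simp: markov_process_def\<close>)
  \<comment> \<open>Adapted rewards are what makes the competitor \<open>S\<close> adapted and puts
    the stopping event \<open>B\<close> into \<open>F n\<close>.\<close>
  have adapted: "(\<lambda>\<omega>. g n (X n \<omega>)) \<in> borel_measurable (nat_filtration M X n)" if "n \<le> N" for n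
    by (rule measurable_compose[OF measurable_nat_filtration assms(4)[OF that]])
  have "(\<integral>\<omega>. (MAX n\<in>{0..N}. g n (X n \<omega>) - MH n \<omega> - \<epsilon> n \<omega>) \<partial>M) +
      (\<integral>\<omega>. (MIN n\<in>{0..N}. AH n \<omega> + \<epsilon> n \<omega>) \<partial>M) \<le> optimal_value M N X g"
    if "snell_envelope M (nat_filtration M X) N (\<lambda>n \<omega>. g n (X n \<omega>)) H"
      "is_version M N (doob_mart M (nat_filtration M X) H) MH"
      "is_version M N (doob_comp M (nat_filtration M X) H) AH" for H MH AH
    unfolding optimal_value_def
    using that adapted assms(5,6) by (rule snell_envelope_lower_bound)
  moreover have "optimal_value M N X g \<le>
      (\<integral>\<omega>. (MAX n\<in>{0..N}. g n (X n \<omega>) - Y n \<omega> - \<epsilon> n \<omega>) \<partial>M)"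
    if "martingale M (nat_filtration M X) N Y" "AE \<omega> in M. Y 0 \<omega> = 0"
      "\<And>n. n \<le> N \<Longrightarrow> AE \<omega> in M. real_cond_exp M (nat_filtration M X n) (\<epsilon> n) \<omega> = 0" for Y
    unfolding optimal_value_def
    using that(1,2) assms(5,6) that(3) by (rule martingale_upper_bound)
  ultimately show ?thesis by blast
qed

end
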